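(* There is no graph $G$ that contains a cycle, has girth at least $6$, and satisfies $\mathrm{mz}(G)\leq 3$.
   Context: All graphs are finite and simple. The girth of a graph is the length of a shortest cycle contained in the graph. Zero forcing: each vertex of a graph $G$ is blue or white. Color change rule: if $x$ is a blue vertex and $y$ is the only white neighbor of $x$, then $y$ turns blue. A set $B\subseteq V(G)$ is a zero forcing set if, starting with exactly the vertices of $B$ blue, all vertices of $G$ can be made blue by repeated applications of the rule. The zero forcing number $Z(G)$ is the minimum cardinality of a zero forcing set of $G$, and $\mathrm{mz}(G)=|V(G)|-Z(G)$. *)

theory Defs
  imports "Graph_Theory.Pair_Digraph" "HOL-Library.Extended_Nat"
begin

text \<open>
  Finite simple graphs are the library's \<open>pair_graph\<close>s: finite, symmetric, loop-free sets of
  arcs, an undirected edge being represented by its two arcs.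
  The library notion \<open>cycle\<close> for arc walks also accepts a walk back and forth along one edge,
  i.e. length 2; the length condition below excludes exactly these walks.
\<close>

definition graph_cycle :: "'a pair_pre_digraph \<Rightarrow> ('a \<times> 'a) list \<Rightarrow> bool" where
  "graph_cycle G p \<longleftrightarrow> pre_digraph.cycle (with_proj G) p \<and> 3 \<le> length p"

text \<open>The infimum over an empty set of cycles is \<open>\<infinity>\<close>; otherwise it is attained.\<close>

definition girth :: "'a pair_pre_digraph \<Rightarrow> enat" where
  "girth G = (INF p\<in>{p. graph_cycle G p}. enat (length p))"

definition nbrs :: "'a pair_pre_digraph \<Rightarrow> 'a \<Rightarrow> 'a set" where
  "nbrs G x = {y. (x, y) \<in> parcs G}"

text \<open>Colourings are represented by their set of blue vertices.\<close>

inductive color_change :: "'a pair_pre_digraph \<Rightarrow> 'a set \<Rightarrow> 'a set \<Rightarrow> bool" for G where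
  "x \<in> S \<Longrightarrow> nbrs G x - S = {y} \<Longrightarrow> color_change G S (insert y S)"

definition zero_forcing_set :: "'a pair_pre_digraph \<Rightarrow> 'a set \<Rightarrow> bool" where
  "zero_forcing_set G B \<longleftrightarrow> B \<subseteq> pverts G \<and> (color_change G)\<^sup>*\<^sup>* B (pverts G)"

definition zero_forcing_number :: "'a pair_pre_digraph \<Rightarrow> nat" where
  "zero_forcing_number G = (LEAST k. \<exists>B. zero_forcing_set G B \<and> card B = k)"

definition mz :: "'a pair_pre_digraph \<Rightarrow> nat" where
  "mz G = card (pverts G) - zero_forcing_number G"

text \<open>The subtraction in \<open>mz\<close> never truncates.\<close>

lemma zero_forcing_number_le: "zero_forcing_number G \<le> card (pverts G)"
  unfolding zero_forcing_number_def
  by (rule Least_le) (auto simp: zero_forcing_set_def)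

end

theory Submission
  imports Defs
begin

text \<open>
  Five consecutive vertices \<open>b, c, d, e, f\<close> on a cycle form an induced path, since a chord would
  close a cycle of length at most 5. Colour everything but \<open>c, d, e, f\<close> blue: then \<open>b\<close>
  forces \<open>c\<close>, \<open>c\<close> forces \<open>d\<close>, \<open>d\<close> forces \<open>e\<close> and \<open>e\<close> forces \<open>f\<close>.
\<close>

lemma girth_le_length:
  assumes "graph_cycle G p"
  shows "girth G \<le> enat (length p)"
  unfolding girth_def using assms by (intro INF_lower) simp

lemma (in pair_graph) arc_sym: "(x, y) \<in> parcs G \<Longrightarrow> (y, x) \<in> parcs G"
  using sym_arcs by (auto simp: symmetric_def dest: symD)

text \<open>Meant for explicit arc lists, where simplification settles every premise. The base point
  is a vertex because it is the tail of the first arc.\<close>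

lemma (in pair_graph) graph_cycleI:
  assumes "set p \<subseteq> parcs G" "cas u p u" "distinct (tl (awalk_verts u p))" "3 \<le> length p"
  shows "graph_cycle G p"
proof -
  obtain v q where p: "p = (u, v) # q"
    using assms(2,4) by (cases p) auto
  then have "u \<in> pverts G"
    using assms(1) in_arcsD1 by auto
  then show ?thesis
    using assms p unfolding graph_cycle_def cycle_def awalk_def by auto
qed

text \<open>A chord and the stretch of path between its ends form a cycle of length 3, 4 or 5,
  according to the distance of the ends along the path.\<close>

lemma (in pair_graph) girth_gt_5_no_short_chords:
  assumes girth: "6 \<le> girth G"
    and dist: "distinct [b, c, d, e, f]"
    and path: "{(b, c), (c, d), (d, e), (e, f)} \<subseteq> parcs G"
  shows "(b, d) \<notin> parcs G" "(b, e) \<notin> parcs G" "(b, f) \<notin> parcs G"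
    "(c, e) \<notin> parcs G" "(c, f) \<notin> parcs G" "(d, f) \<notin> parcs G"
proof -
  have short: "\<not> graph_cycle G p" if "length p \<le> 5" for p
  proof
    assume "graph_cycle G p"
    then have "6 \<le> enat (length p)"
      using girth girth_le_length order_trans by blast
    then show False
      using that by (simp add: numeral_eq_enat)
  qed
  \<comment> \<open>The chord points along the path; its reverse, given by \<open>arc_sym\<close>,
    closes the directed walk.\<close>
  have chord3: False if "distinct [x, y, z]" "{(x, y), (y, z), (x, z)} \<subseteq> parcs G" for x y z
    using short[of "[(x, y), (y, z), (z, x)]"] graph_cycleI[of "[(x, y), (y, z), (z, x)]" x]
      that arc_sym[of x z] by auto
  have chord4: False
    if "distinct [w, x, y, z]" "{(w, x), (x, y), (y, z), (w, z)} \<subseteq> parcs G" for w x y z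
    using short[of "[(w, x), (x, y), (y, z), (z, w)]"]
      graph_cycleI[of "[(w, x), (x, y), (y, z), (z, w)]" w] that arc_sym[of w z] by auto
  show "(b, d) \<notin> parcs G" "(c, e) \<notin> parcs G" "(d, f) \<notin> parcs G"
    using chord3[of b c d] chord3[of c d e] chord3[of d e f] dist path by auto
  show "(b, e) \<notin> parcs G" "(c, f) \<notin> parcs G"
    using chord4[of b c d e] chord4[of c d e f] dist path by auto
  \<comment> \<open>This chord closes a 5-cycle, the case where girth 5 would not suffice.\<close>
  show "(b, f) \<notin> parcs G"
    using short[of "[(b, c), (c, d), (d, e), (e, f), (f, b)]"]
      graph_cycleI[of "[(b, c), (c, d), (d, e), (e, f), (f, b)]" b] dist path arc_sym[of b f] by auto
qed

text \<open>When a path vertex forces, every vertex before it is blue and the later ones beyond its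
  successor are not adjacent to it, so its successor is its only white neighbor.\<close>

lemma (in pair_graph) induced_path_zero_forcing_set:
  assumes dist: "distinct [b, c, d, e, f]"
    and path: "{(b, c), (c, d), (d, e), (e, f)} \<subseteq> parcs G"
    and induced: "(b, d) \<notin> parcs G" "(b, e) \<notin> parcs G" "(b, f) \<notin> parcs G"
      "(c, e) \<notin> parcs G" "(c, f) \<notin> parcs G" "(d, f) \<notin> parcs G"
  shows "zero_forcing_set G (pverts G - {c, d, e, f})"
proof -
  define V where "V = pverts G"
  have arcs: "x \<in> V \<and> y \<in> V" if "(x, y) \<in> parcs G" for x y
    using that in_arcsD1 in_arcsD2 unfolding V_def by blast
  then have V: "b \<in> V" "c \<in> V" "d \<in> V" "e \<in> V" "f \<in> V"
    using path by auto
  define B where "B = V - {c, d, e, f}"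
  have 1: "color_change G B (insert c B)"
    by (rule color_change.intros[of b])
      (use dist path induced V arcs in \<open>auto simp: B_def nbrs_def\<close>)
  have 2: "color_change G (insert c B) (insert d (insert c B))"
    by (rule color_change.intros[of c])
      (use dist path induced V arcs in \<open>auto simp: B_def nbrs_def\<close>)
  have 3: "color_change G (insert d (insert c B)) (insert e (insert d (insert c B)))"
    by (rule color_change.intros[of d])
      (use dist path induced V arcs in \<open>auto simp: B_def nbrs_def\<close>)
  have 4: "color_change G (insert e (insert d (insert c B)))
      (insert f (insert e (insert d (insert c B))))"
    by (rule color_change.intros[of e])
      (use dist path induced V arcs in \<open>auto simp: B_def nbrs_def\<close>)
  have "insert f (insert e (insert d (insert c B))) = V"
    using V by (auto simp: B_def)
  with 1 2 3 4 have "(color_change G)\<^sup>*\<^sup>* B V"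
    by (metis converse_rtranclp_into_rtranclp rtranclp.rtrancl_refl)
  then show ?thesis
    unfolding zero_forcing_set_def B_def V_def by auto
qed

lemma zero_forcing_number_le_card:
  assumes "zero_forcing_set G B"
  shows "zero_forcing_number G \<le> card B"
  unfolding zero_forcing_number_def using assms by (intro Least_le) blast

lemma (in pair_graph) mz_ge_4:
  assumes cyc: "graph_cycle G p" and girth: "6 \<le> girth G"
  shows "4 \<le> mz G"
proof -
  have "6 \<le> enat (length p)"
    using girth girth_le_length[OF cyc] order_trans by blast
  then have len: "6 \<le> length p"
    by (simp add: numeral_eq_enat)
  obtain u where walk: "awalk u p u" and dist: "distinct (tl (awalk_verts u p))"
    using cyc unfolding graph_cycle_def cycle_def by blast
  \<comment> \<open>The first arc is split off only to reach \<open>b\<close>: distinctness is known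
    for the tail of the vertex list, which omits the starting point \<open>u\<close>.\<close>
  obtain x0 x1 x2 x3 x4 q where p: "p = x0 # x1 # x2 # x3 # x4 # q"
    using len by (auto simp: numeral_eq_Suc Suc_le_length_iff)
  obtain b c d e f where
    x: "x0 = (u, b)" "x1 = (b, c)" "x2 = (c, d)" "x3 = (d, e)" "x4 = (e, f)"
    using walk unfolding awalk_def p
    by (cases x0; cases x1; cases x2; cases x3; cases x4) auto
  have path: "{(b, c), (c, d), (d, e), (e, f)} \<subseteq> parcs G"
    using walk unfolding awalk_def p x by auto
  \<comment> \<open>The tail of the vertex list is \<open>b # c # d # e # awalk_verts f q\<close>,
    so this brings \<open>f\<close> under the distinctness condition.\<close>
  have "f \<in> set (awalk_verts f q)"
    using walk unfolding awalk_def p x by (cases q) auto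
  then have dist': "distinct [b, c, d, e, f]"
    using dist unfolding p x by auto
  have "zero_forcing_number G \<le> card (pverts G - {c, d, e, f})"
    using induced_path_zero_forcing_set[OF dist' path
        girth_gt_5_no_short_chords[OF girth dist' path]]
    by (rule zero_forcing_number_le_card)
  moreover have sub: "{c, d, e, f} \<subseteq> pverts G"
    using path in_arcsD2 by blast
  moreover have "card {c, d, e, f} = 4"
    using dist' by simp
  \<comment> \<open>\<open>card_mono\<close> gives at least 4 vertices, so subtracting 4 on the
    naturals does not truncate.\<close>
  ultimately show ?thesis
    using card_Diff_subset[OF _ sub] card_mono[OF _ sub] unfolding mz_def by simp
qed

theorem proposition9:
  shows "\<not> (\<exists>G :: 'a pair_pre_digraph.
    pair_graph G \<and> (\<exists>p. graph_cycle G p) \<and> 6 \<le> girth G \<and> mz G \<le> 3)"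
  using pair_graph.mz_ge_4 by fastforce

end
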